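(* Let $(X,d_X)$ be a metric space satisfying the discretization assumption with encoders $\{\phi_n\}$, decoders $\{\psi_n\}$, projection mappings $P_n=\psi_n\circ\phi_n$ and dimension function $\kappa$. Let $Y$ be a Banach space, let $K\subset X$ be compact, and let $\mathcal{G}:K\to Y$ be a continuous mapping. Then for any $\epsilon>0$ there exist positive integers $p,q$, a continuous mapping $\tilde{\mathcal{G}}:\mathbb{R}^{\kappa(q)}\to\mathbb{R}^p$ and a mapping $u\in C(\mathbb{R}^p,Y)$ such that $$\sup_{v\in K}\left\|\mathcal{G}(v)-u\circ\tilde{\mathcal{G}}(\phi_q(v))\right\|_Y<\epsilon .$$
   Context: $\mathbb{N}^*$ denotes the set of positive integers; $C(A,B)$ denotes the set of continuous maps from $A$ to $B$. Discretization assumption for a metric space $(X,d_X)$: there are a strictly monotonically increasing function $\kappa:\mathbb{N}^*\to\mathbb{N}^*$ and two families of mappings $\{\phi_n\}_{n\in\mathbb{N}^*}$ (encoders) and $\{\psi_n\}_{n\in\mathbb{N}^*}$ (decoders) with $\phi_n\in C(X,\mathbb{R}^{\kappa(n)})$, $\psi_n\in C(\phi_n(X),X)$, such that $P_n:=\psi_n\circ\phi_n\in C(X,X)$ satisfies $$\lim_{n\to\infty}\sup_{x\in K}d_X(x,P_n(x))=0$$ for every compact $K\subset X$. *)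

theory Defs
  imports "HOL-Analysis.Analysis"
begin

text \<open>
  \<open>\<real>\<^sup>m\<close> with varying \<open>m\<close> is the library's \<^const>\<open>Euclidean_space\<close> \<open>m\<close>: the sequences
  \<open>nat \<Rightarrow> real\<close> vanishing at all indices \<open>\<ge> m\<close>, with the product topology.
  The families are indexed by the positive integers; their values at \<open>0\<close> are irrelevant.
\<close>

definition projection ::
  "(nat \<Rightarrow> 'a \<Rightarrow> nat \<Rightarrow> real) \<Rightarrow> (nat \<Rightarrow> (nat \<Rightarrow> real) \<Rightarrow> 'a) \<Rightarrow> nat \<Rightarrow> 'a \<Rightarrow> 'a"
  where "projection \<phi> \<psi> n = \<psi> n \<circ> \<phi> n"

text \<open>
  Suprema of distances are taken in \<^typ>\<open>ennreal\<close>, so that they always exist and the supremum over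
  the empty set is \<open>0\<close>.
\<close>

definition discretization ::
  "(nat \<Rightarrow> nat) \<Rightarrow> (nat \<Rightarrow> 'a::metric_space \<Rightarrow> nat \<Rightarrow> real) \<Rightarrow>
   (nat \<Rightarrow> (nat \<Rightarrow> real) \<Rightarrow> 'a) \<Rightarrow> bool"
  where "discretization \<kappa> \<phi> \<psi> \<longleftrightarrow>
    (\<forall>n\<ge>1. \<kappa> n \<ge> 1) \<and> strict_mono_on {1..} \<kappa> \<and>
    (\<forall>n\<ge>1. continuous_map euclidean (Euclidean_space (\<kappa> n)) (\<phi> n)) \<and>
    (\<forall>n\<ge>1. continuous_map (subtopology (Euclidean_space (\<kappa> n)) (range (\<phi> n))) euclidean (\<psi> n)) \<and>
    (\<forall>n\<ge>1. continuous_on UNIV (projection \<phi> \<psi> n)) \<and>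
    (\<forall>K. compact K \<longrightarrow>
      (\<lambda>n. SUP x\<in>K. ennreal (dist x (projection \<phi> \<psi> n x))) \<longlonglongrightarrow> 0)"

end

theory Submission
  imports Defs
begin

text \<open>
  Cover \<open>K\<close> by small balls around \<open>x 0, \<dots>, x (p - 1)\<close> and use the partition of unity subordinate to
  slightly larger balls, which still works on points near \<open>K\<close> such as \<open>P\<^sub>q v\<close>. Its members composed
  with the decoder are continuous on the compact set \<open>\<phi>\<^sub>q(K)\<close>, so Tietze's theorem extends them to the
  coordinates of \<open>Gt\<close>; the map \<open>u\<close> is the linear combination of the values \<open>G (x i)\<close>. This avoids
  evaluating \<open>G\<close> at \<open>P\<^sub>q v\<close>, which need not lie in \<open>K\<close>.
\<close>

text \<open>As the weights sum to 1, \<open>y\<close> is itself the combination of copies of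
  \<open>y\<close>, so the difference is a weighted sum of the \<open>y - z i\<close>. Asking for
  closeness only where the weight is nonzero is what makes the bound usable with a partition of
  unity.\<close>

lemma norm_diff_convex_combination_le:
  fixes y :: "'b::real_normed_vector"
  assumes "\<And>i. i \<in> I \<Longrightarrow> 0 \<le> l i" and "sum l I = 1"
    and "\<And>i. i \<in> I \<Longrightarrow> l i \<noteq> 0 \<Longrightarrow> norm (y - z i) \<le> e"
  shows "norm (y - (\<Sum>i\<in>I. l i *\<^sub>R z i)) \<le> e"
proof -
  have "y - (\<Sum>i\<in>I. l i *\<^sub>R z i) = (\<Sum>i\<in>I. l i *\<^sub>R (y - z i))"
    by (simp add: scaleR_diff_right sum_subtractf assms(2) flip: scaleR_left.sum)
  also have "norm \<dots> \<le> (\<Sum>i\<in>I. l i * e)"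
  proof (rule sum_norm_le)
    fix i assume i: "i \<in> I"
    show "norm (l i *\<^sub>R (y - z i)) \<le> l i * e"
    proof (cases "l i = 0")
      case False
      then show ?thesis
        using assms(1,3)[OF i] by (simp add: mult_left_mono)
    qed simp
  qed
  also have "\<dots> = e"
    by (simp add: assms(2) flip: sum_distrib_right)
  finally show ?thesis .
qed

lemma Euclidean_space_eq_top_of_set:
  "Euclidean_space n = top_of_set {x. \<forall>i\<ge>n. x i = 0}"
  by (simp add: Euclidean_space_def euclidean_product_topology)

text \<open>Tietze is applied to each coordinate on the whole sequence space; the extension is then
  restricted to \<open>Euclidean_space m\<close>. Padding with 0 from index \<open>p\<close> on puts
  the values in \<open>Euclidean_space p\<close>.\<close>

lemma continuous_map_Euclidean_space_extension:
  fixes f :: "(nat \<Rightarrow> real) \<Rightarrow> nat \<Rightarrow> real"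
  assumes "closed S" and "\<And>i. i < p \<Longrightarrow> continuous_on S (\<lambda>t. f t i)"
  obtains g where "continuous_map (Euclidean_space m) (Euclidean_space p) g"
    and "\<And>t i. t \<in> S \<Longrightarrow> i < p \<Longrightarrow> g t i = f t i"
proof -
  have "\<exists>h. continuous_on UNIV h \<and> (\<forall>t\<in>S. h t = f t i)" if "i < p" for i
    using Tietze_unbounded[of S "\<lambda>t. f t i" UNIV] assms that by (metis closed_closedin subtopology_UNIV)
  then obtain h where h: "\<And>i. i < p \<Longrightarrow> continuous_on UNIV (h i)"
      "\<And>i t. i < p \<Longrightarrow> t \<in> S \<Longrightarrow> h i t = f t i"
    by metis
  define g where "g t i = (if i < p then h i t else 0)" for t i
  have "continuous_on UNIV (\<lambda>t. g t i)" for i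
    using h(1) by (cases "i < p") (simp_all add: g_def)
  then have "continuous_on UNIV g"
    by (rule continuous_on_coordinatewise_then_product)
  then have "continuous_map (Euclidean_space m) (Euclidean_space p) g"
    unfolding Euclidean_space_eq_top_of_set
    by (auto simp: continuous_map_in_subtopology g_def intro: continuous_on_subset)
  then show thesis
    using h(2) by (intro that[of g]) (auto simp: g_def)
qed

theorem theorem1:
  fixes \<kappa> :: "nat \<Rightarrow> nat"
    and \<phi> :: "nat \<Rightarrow> 'a::metric_space \<Rightarrow> nat \<Rightarrow> real"
    and \<psi> :: "nat \<Rightarrow> (nat \<Rightarrow> real) \<Rightarrow> 'a"
    and K :: "'a set"
    and G :: "'a \<Rightarrow> 'b::banach"
    and \<epsilon> :: real
  assumes "discretization \<kappa> \<phi> \<psi>"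
    and "compact K"
    and "continuous_on K G"
    and "\<epsilon> > 0"
  shows "\<exists>p q :: nat. \<exists>Gt :: (nat \<Rightarrow> real) \<Rightarrow> nat \<Rightarrow> real. \<exists>u :: (nat \<Rightarrow> real) \<Rightarrow> 'b.
    p \<ge> 1 \<and> q \<ge> 1 \<and>
    continuous_map (Euclidean_space (\<kappa> q)) (Euclidean_space p) Gt \<and>
    continuous_map (Euclidean_space p) euclidean u \<and>
    (SUP v\<in>K. ennreal (norm (G v - (u \<circ> Gt) (\<phi> q v)))) < ennreal \<epsilon>"
proof (cases "K = {}")
  \<comment> \<open>Treated apart because a minimal cover could be empty, giving
    \<open>p = 0\<close>; here the supremum is 0 and zero maps suffice.\<close>
  case True
  have "continuous_map (Euclidean_space (\<kappa> 1)) (Euclidean_space 1) (\<lambda>_ _. 0)"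
    by (simp add: topspace_Euclidean_space)
  then show ?thesis
    using True \<open>\<epsilon> > 0\<close>
    by (intro exI[of _ "1::nat"] exI[of _ "\<lambda>_ _. 0"] exI[of _ "\<lambda>_. 0"]) (simp add: bot_ennreal)
next
  case False
  have "uniformly_continuous_on K G"
    using assms by (simp add: compact_uniformly_continuous)
  \<comment> \<open>Pointwise bounds pass to the supremum only as a non-strict inequality; the
    halving restores strictness.\<close>
  moreover have "\<epsilon> / 2 > 0"
    using \<open>\<epsilon> > 0\<close> by simp
  ultimately obtain d where "d > 0"
    and d: "\<And>v v'. v \<in> K \<Longrightarrow> v' \<in> K \<Longrightarrow> dist v v' < d \<Longrightarrow> norm (G v - G v') < \<epsilon> / 2"
    unfolding uniformly_continuous_on_def dist_norm by metis
  \<comment> \<open>One \<open>r\<close> pays for the distance from \<open>v\<close> to its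
    projection, two for that from the projection to a centre \<open>x i\<close> of nonzero
    weight.\<close>
  define r where "r = d / 3"
  have "r > 0"
    using \<open>d > 0\<close> by (simp add: r_def)
  obtain C where C: "finite C" "C \<subseteq> K" "K \<subseteq> (\<Union>c\<in>C. ball c r)"
    using compactE_image[OF \<open>compact K\<close>, of K "\<lambda>c. ball c r"] \<open>r > 0\<close>
    by (metis UN_I centre_in_ball open_ball subsetI)
  define p where "p = card C"
  have "p \<ge> 1"
    using C False by (auto simp: p_def Suc_le_eq card_gt_0_iff)
  obtain x where "bij_betw x {0..<p} C"
    unfolding p_def using ex_bij_betw_nat_finite C(1) by blast
  then have x: "x ` {..<p} = C"
    by (simp add: bij_betw_def atLeast0LessThan)
  \<comment> \<open>Tent functions of radius \<open>2 * r\<close>, twice that of the covering balls: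
    a point less than \<open>r\<close> away from \<open>K\<close> still has a positive
    weight.\<close>
  define w where "w i z = max 0 (2 * r - dist z (x i))" for i z
  define W where "W z = (\<Sum>i<p. w i z)" for z
  have w_nonneg: "w i z \<ge> 0" for i z
    by (simp add: w_def)

  have P_lim: "(\<lambda>n. SUP v\<in>K. ennreal (dist v (projection \<phi> \<psi> n v))) \<longlonglongrightarrow> 0"
    using assms by (simp add: discretization_def)
  have "eventually (\<lambda>n. (SUP v\<in>K. ennreal (dist v (projection \<phi> \<psi> n v))) < ennreal r) sequentially"
    using order_tendstoD(2)[OF P_lim] \<open>r > 0\<close> by simp
  \<comment> \<open>The threshold from the limit may be 0, hence its maximum with 1.\<close>
  then obtain q where "q \<ge> 1"
    and q: "(SUP v\<in>K. ennreal (dist v (projection \<phi> \<psi> q v))) < ennreal r"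
    unfolding eventually_sequentially by (metis max.cobounded1 max.cobounded2)
  have P_close: "dist v (\<psi> q (\<phi> q v)) < r" if "v \<in> K" for v
  proof -
    have "ennreal (dist v (projection \<phi> \<psi> q v)) < ennreal r"
      using q that by (meson SUP_upper order_le_less_trans)
    then show ?thesis
      by (simp add: projection_def ennreal_less_iff)
  qed
  have W_pos: "W (\<psi> q (\<phi> q v)) > 0" if "v \<in> K" for v
  proof -
    obtain c where "c \<in> C" "dist c v < r"
      using C(3) \<open>v \<in> K\<close> by auto
    then obtain i where "i < p" "dist (x i) v < r"
      using x by auto
    then have "w i (\<psi> q (\<phi> q v)) > 0"
      using P_close[OF that] dist_triangle[of "\<psi> q (\<phi> q v)" "x i" v]
      by (simp add: w_def dist_commute)
    then show ?thesis
      unfolding W_def using \<open>i < p\<close> by (intro sum_pos2[of _ i]) (auto simp: w_nonneg)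
  qed

  define S where "S = \<phi> q ` K"
  have "continuous_map euclidean (Euclidean_space (\<kappa> q)) (\<phi> q)"
    and \<psi>_cont: "continuous_map (subtopology (Euclidean_space (\<kappa> q)) (range (\<phi> q))) euclidean (\<psi> q)"
    using assms(1) \<open>q \<ge> 1\<close> by (simp_all add: discretization_def)
  then have \<phi>_cont: "continuous_on UNIV (\<phi> q)" and \<phi>_range: "range (\<phi> q) \<subseteq> {t. \<forall>i\<ge>\<kappa> q. t i = 0}"
    by (auto simp: Euclidean_space_eq_top_of_set continuous_map_in_subtopology)
  have "closed S"
    unfolding S_def using \<phi>_cont \<open>compact K\<close>
    by (meson compact_continuous_image compact_imp_closed continuous_on_subset subset_UNIV)
  have "continuous_on (range (\<phi> q)) (\<psi> q)"
    using \<psi>_cont \<phi>_range by (simp add: Euclidean_space_eq_top_of_set subtopology_subtopology Int_absorb1)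
  then have "continuous_on S (\<psi> q)"
    by (rule continuous_on_subset) (auto simp: S_def)
  \<comment> \<open>The quotients below are controlled on \<open>S\<close> only: \<open>W\<close>
    may vanish at decoded points far from \<open>K\<close>, and \<open>\<psi> q\<close> is
    continuous only on the range of the encoder. Hence the extension from \<open>S\<close>.\<close>
  moreover have "W (\<psi> q t) \<noteq> 0" if "t \<in> S" for t
    using W_pos that by (force simp: S_def)
  ultimately have "continuous_on S (\<lambda>t. w i (\<psi> q t) / W (\<psi> q t))" for i
    unfolding w_def W_def by (intro continuous_intros) auto
  then obtain Gt where Gt_cont: "continuous_map (Euclidean_space (\<kappa> q)) (Euclidean_space p) Gt"
    and Gt: "\<And>t i. t \<in> S \<Longrightarrow> i < p \<Longrightarrow> Gt t i = w i (\<psi> q t) / W (\<psi> q t)"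
    using continuous_map_Euclidean_space_extension[OF \<open>closed S\<close>,
        of p "\<lambda>t i. w i (\<psi> q t) / W (\<psi> q t)"] by metis

  define u where "u t = (\<Sum>i<p. t i *\<^sub>R G (x i))" for t :: "nat \<Rightarrow> real"
  have "continuous_on UNIV u"
    unfolding u_def by (intro continuous_intros continuous_on_product_coordinates)
  then have u_cont: "continuous_map (Euclidean_space p) euclidean u"
    by (auto simp: Euclidean_space_eq_top_of_set intro: continuous_on_subset)

  have error: "norm (G v - (u \<circ> Gt) (\<phi> q v)) \<le> \<epsilon> / 2" if "v \<in> K" for v
  proof -
    let ?z = "\<psi> q (\<phi> q v)"
    have "(u \<circ> Gt) (\<phi> q v) = (\<Sum>i<p. (w i ?z / W ?z) *\<^sub>R G (x i))"
      using that by (simp add: u_def Gt S_def)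
    moreover have "norm (G v - (\<Sum>i<p. (w i ?z / W ?z) *\<^sub>R G (x i))) \<le> \<epsilon> / 2"
    proof (rule norm_diff_convex_combination_le)
      show "0 \<le> w i ?z / W ?z" for i
        using W_pos[OF that] by (simp add: w_nonneg)
      show "(\<Sum>i<p. w i ?z / W ?z) = 1"
        using W_pos[OF that] by (simp add: W_def flip: sum_divide_distrib)
    next
      \<comment> \<open>\<open>G\<close> is compared only at \<open>v\<close> and
        \<open>x i\<close>, both in \<open>K\<close>; the projected point \<open>?z\<close> serves
        merely as an intermediate point in the triangle inequality.\<close>
      fix i assume "i \<in> {..<p}" "w i ?z / W ?z \<noteq> 0"
      then have "dist ?z (x i) < 2 * r" "x i \<in> K"
        using C(2) x by (auto simp: w_def max_def split: if_splits)
      then have "dist v (x i) < d"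
        using P_close[OF that] dist_triangle[of v "x i" ?z] by (simp add: r_def)
      then show "norm (G v - G (x i)) \<le> \<epsilon> / 2"
        using d[OF that \<open>x i \<in> K\<close>] by simp
    qed
    ultimately show ?thesis
      by simp
  qed
  have "(SUP v\<in>K. ennreal (norm (G v - (u \<circ> Gt) (\<phi> q v)))) \<le> ennreal (\<epsilon> / 2)"
    using error by (intro SUP_least ennreal_leI)
  also have "\<dots> < ennreal \<epsilon>"
    using \<open>\<epsilon> > 0\<close> by (simp add: ennreal_less_iff)
  finally show ?thesis
    using \<open>p \<ge> 1\<close> \<open>q \<ge> 1\<close> Gt_cont u_cont by blast
qed

end
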